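(* For every C*-algebra $A$, the relation $\ll_{\mathrm{sm}}$ in $\mathrm{Id}_A$ is a transitive $\mathbf{H}$-relation.
   Context: For a C*-algebra $A$, $\mathrm{Id}_A$ is the lattice of all closed two-sided ideals of $A$ (called ideals), ordered by inclusion; $I\vee J=I+J$. If $A\neq\{0\}$, an ideal $I\in\mathrm{Id}_A$ is small in $A$ if $I+K\neq A$ for all $K\in\mathrm{Id}_A$ with $K\neq A$. If $A=\{0\}$ then $\{0\}$ is a small ideal of $A$. The relation $\ll_{\mathrm{sm}}=\ll_{\mathrm{sm}}^A$ in $\mathrm{Id}_A$ is: $I\ll_{\mathrm{sm}}J$ iff $I\subseteq J$ and $J/I$ is a small ideal in $A/I$. An $\mathbf{H}$-relation in $\mathrm{Id}_A$ is a reflexive relation $\ll$, with $I\ll J\Rightarrow I\subseteq J$, such that $I\ll J$ and $I\subseteq K$ imply $K\ll J+K$ (equivalently, $I\ll J$ implies $I+K\ll J+K$ for all $K\in\mathrm{Id}_A$). *)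

theory Defs
  imports "HOL-Analysis.Analysis" "HOL-Algebra.Module" "HOL-Algebra.QuotRing"
begin

definition complex_ring :: "complex ring" where
  "complex_ring = \<lparr>carrier = UNIV, mult = (*), one = 1, zero = 0, add = (+)\<rparr>"

text \<open>
  C*-algebras are modelled on a carrier set, because the quotients \<open>A/I\<close> have to be C*-algebras
  as well. They are not assumed to be unital: the field \<^const>\<open>one\<close>, inherited from the ring
  record, is not constrained by any axiom and is never used.
\<close>

record 'a cstar_struct = "(complex, 'a) module" +
  star :: "'a \<Rightarrow> 'a"
  nrm :: "'a \<Rightarrow> real"

text \<open>
  The library's \<^const>\<open>Metric_space.mtopology\<close> expects a total function that is nonnegative and
  symmetric on the whole type, hence the value 0 off the carrier.
\<close>

definition ndist :: "('a, 'b) cstar_struct_scheme \<Rightarrow> 'a \<Rightarrow> 'a \<Rightarrow> real" where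
  "ndist A x y =
     (if x \<in> carrier A \<and> y \<in> carrier A then nrm A (x \<ominus>\<^bsub>A\<^esub> y) else 0)"

definition norm_topology :: "('a, 'b) cstar_struct_scheme \<Rightarrow> 'a topology" where
  "norm_topology A = Metric_space.mtopology (carrier A) (ndist A)"

locale cstar_algebra = module complex_ring A for A :: "'a cstar_struct" (structure) +
  assumes mult_closed:
      "\<lbrakk>x \<in> carrier A; y \<in> carrier A\<rbrakk> \<Longrightarrow> x \<otimes>\<^bsub>A\<^esub> y \<in> carrier A"
    and mult_assoc:
      "\<lbrakk>x \<in> carrier A; y \<in> carrier A; z \<in> carrier A\<rbrakk> \<Longrightarrow>
        (x \<otimes>\<^bsub>A\<^esub> y) \<otimes>\<^bsub>A\<^esub> z = x \<otimes>\<^bsub>A\<^esub> (y \<otimes>\<^bsub>A\<^esub> z)"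
    and mult_distrib_left:
      "\<lbrakk>x \<in> carrier A; y \<in> carrier A; z \<in> carrier A\<rbrakk> \<Longrightarrow>
        x \<otimes>\<^bsub>A\<^esub> (y \<oplus>\<^bsub>A\<^esub> z) = x \<otimes>\<^bsub>A\<^esub> y \<oplus>\<^bsub>A\<^esub> x \<otimes>\<^bsub>A\<^esub> z"
    and mult_distrib_right:
      "\<lbrakk>x \<in> carrier A; y \<in> carrier A; z \<in> carrier A\<rbrakk> \<Longrightarrow>
        (x \<oplus>\<^bsub>A\<^esub> y) \<otimes>\<^bsub>A\<^esub> z = x \<otimes>\<^bsub>A\<^esub> z \<oplus>\<^bsub>A\<^esub> y \<otimes>\<^bsub>A\<^esub> z"
    and smult_mult_left:
      "\<lbrakk>x \<in> carrier A; y \<in> carrier A\<rbrakk> \<Longrightarrow>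
        (c \<odot>\<^bsub>A\<^esub> x) \<otimes>\<^bsub>A\<^esub> y = c \<odot>\<^bsub>A\<^esub> (x \<otimes>\<^bsub>A\<^esub> y)"
    and smult_mult_right:
      "\<lbrakk>x \<in> carrier A; y \<in> carrier A\<rbrakk> \<Longrightarrow>
        x \<otimes>\<^bsub>A\<^esub> (c \<odot>\<^bsub>A\<^esub> y) = c \<odot>\<^bsub>A\<^esub> (x \<otimes>\<^bsub>A\<^esub> y)"
    and star_closed: "x \<in> carrier A \<Longrightarrow> star A x \<in> carrier A"
    and star_star: "x \<in> carrier A \<Longrightarrow> star A (star A x) = x"
    and star_add:
      "\<lbrakk>x \<in> carrier A; y \<in> carrier A\<rbrakk> \<Longrightarrow> star A (x \<oplus>\<^bsub>A\<^esub> y) = star A x \<oplus>\<^bsub>A\<^esub> star A y"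
    and star_smult: "x \<in> carrier A \<Longrightarrow> star A (c \<odot>\<^bsub>A\<^esub> x) = cnj c \<odot>\<^bsub>A\<^esub> star A x"
    and star_mult:
      "\<lbrakk>x \<in> carrier A; y \<in> carrier A\<rbrakk> \<Longrightarrow> star A (x \<otimes>\<^bsub>A\<^esub> y) = star A y \<otimes>\<^bsub>A\<^esub> star A x"
    and nrm_nonneg: "x \<in> carrier A \<Longrightarrow> 0 \<le> nrm A x"
    and nrm_eq_zero_iff: "x \<in> carrier A \<Longrightarrow> nrm A x = 0 \<longleftrightarrow> x = \<zero>\<^bsub>A\<^esub>"
    and nrm_triangle:
      "\<lbrakk>x \<in> carrier A; y \<in> carrier A\<rbrakk> \<Longrightarrow> nrm A (x \<oplus>\<^bsub>A\<^esub> y) \<le> nrm A x + nrm A y"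
    and nrm_smult: "x \<in> carrier A \<Longrightarrow> nrm A (c \<odot>\<^bsub>A\<^esub> x) = cmod c * nrm A x"
    and nrm_mult:
      "\<lbrakk>x \<in> carrier A; y \<in> carrier A\<rbrakk> \<Longrightarrow> nrm A (x \<otimes>\<^bsub>A\<^esub> y) \<le> nrm A x * nrm A y"
    and nrm_star_mult_self: "x \<in> carrier A \<Longrightarrow> nrm A (star A x \<otimes>\<^bsub>A\<^esub> x) = (nrm A x)\<^sup>2"
    and complete: "Metric_space.mcomplete (carrier A) (ndist A)"

definition closed_ideal :: "'a set \<Rightarrow> 'a cstar_struct \<Rightarrow> bool" where
  "closed_ideal I A \<longleftrightarrow>
     submodule I complex_ring A \<and>
     (\<forall>a\<in>carrier A. \<forall>x\<in>I. a \<otimes>\<^bsub>A\<^esub> x \<in> I \<and> x \<otimes>\<^bsub>A\<^esub> a \<in> I) \<and>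
     closedin (norm_topology A) I"

definition ideals :: "'a cstar_struct \<Rightarrow> 'a set set" where
  "ideals A = {I. closed_ideal I A}"

text \<open>
  The quotient \<open>A/I\<close>, with the quotient norm. As in \<^const>\<open>rcoset_mult\<close>, an operation on cosets is
  the union of the cosets of the results over all representatives; taking images of cosets would
  be wrong for multiplication by the scalar 0.
\<close>

definition quotient_alg :: "'a cstar_struct \<Rightarrow> 'a set \<Rightarrow> 'a set cstar_struct" where
  "quotient_alg A I =
     \<lparr>carrier = a_rcosets\<^bsub>A\<^esub> I,
      mult = rcoset_mult A I,
      one = I +>\<^bsub>A\<^esub> \<one>\<^bsub>A\<^esub>,
      zero = I,
      add = set_add A,
      smult = (\<lambda>c X. \<Union>x\<in>X. I +>\<^bsub>A\<^esub> (c \<odot>\<^bsub>A\<^esub> x)),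
      star = (\<lambda>X. \<Union>x\<in>X. I +>\<^bsub>A\<^esub> star A x),
      nrm = (\<lambda>X. INF x\<in>X. nrm A x)\<rparr>"

definition quotient_ideal :: "'a cstar_struct \<Rightarrow> 'a set \<Rightarrow> 'a set \<Rightarrow> 'a set set" where
  "quotient_ideal A J I = (\<lambda>x. I +>\<^bsub>A\<^esub> x) ` J"

definition small_ideal :: "'a cstar_struct \<Rightarrow> 'a set \<Rightarrow> bool" where
  "small_ideal A I \<longleftrightarrow>
     I \<in> ideals A \<and>
     (if carrier A = {\<zero>\<^bsub>A\<^esub>} then I = {\<zero>\<^bsub>A\<^esub>}
      else \<forall>K\<in>ideals A. K \<noteq> carrier A \<longrightarrow> I <+>\<^bsub>A\<^esub> K \<noteq> carrier A)"

definition small_rel :: "'a cstar_struct \<Rightarrow> 'a set rel" where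
  "small_rel A =
     {(I, J). I \<in> ideals A \<and> J \<in> ideals A \<and> I \<subseteq> J \<and>
        small_ideal (quotient_alg A I) (quotient_ideal A J I)}"

text \<open>
  Since \<open>R \<subseteq> ideals A \<times> ideals A\<close> is required, the last condition includes that the algebraic sum
  \<open>J + K\<close> is again a closed ideal.
\<close>

definition H_relation :: "'a cstar_struct \<Rightarrow> 'a set rel \<Rightarrow> bool" where
  "H_relation A R \<longleftrightarrow>
     R \<subseteq> ideals A \<times> ideals A \<and>
     refl_on (ideals A) R \<and>
     (\<forall>I J. (I, J) \<in> R \<longrightarrow> I \<subseteq> J) \<and>
     (\<forall>I J K. (I, J) \<in> R \<and> K \<in> ideals A \<and> I \<subseteq> K \<longrightarrow> (K, J <+>\<^bsub>A\<^esub> K) \<in> R)"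

end

theory Submission
  imports Defs
begin

text \<open>
  Closed ideals of \<open>A/I\<close> correspond to closed ideals of \<open>A\<close> containing \<open>I\<close>, and this correspondence
  respects sums. Hence \<open>(I, J)\<close> belongs to the relation iff \<open>I \<subseteq> J\<close> and every closed ideal
  \<open>K \<supseteq> I\<close> with \<open>J + K = A\<close> is all of \<open>A\<close> (\<open>small_rel_iff\<close>). The degenerate quotient \<open>I = A\<close>
  fits this description, as then \<open>K = A\<close> is the only candidate.

  Everything else is lattice theory. If \<open>I \<lless> J \<lless> L\<close>, \<open>K \<supseteq> I\<close> and \<open>L + K = A\<close>, then \<open>J + K\<close> is an
  ideal above \<open>J\<close> with \<open>L + (J + K) = A\<close>, so \<open>J + K = A\<close>, and so \<open>K = A\<close>. The
  remaining condition holds because an ideal \<open>L \<supseteq> K\<close> with \<open>(J + K) + L = A\<close> satisfies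
  \<open>J + L = A\<close>. The analytic input is that \<open>J + K\<close> is norm closed.

  The sum of two closed ideals is closed (\<open>closed_ideal_set_add\<close>) as soon as every element \<open>x\<close> of
  the first one has right approximate units that are bounded independently of \<open>x\<close>: if
  \<open>i u\<close> is close to \<open>i\<close>, then \<open>i + j = (i + j u) + (j - j u)\<close>, and the first summand is controlled
  by the norm of \<open>i + j\<close> (\<open>bounded_decomposition\<close>), so a convergent sequence in the sum can
  be corrected step by step to one whose first components converge.

  The bounded approximate units (\<open>bounded_right_approximate_unit\<close>) come from a Cayley transform.
  For a skew-adjoint \<open>z = \<i> c x\<^sup>* x\<close> of norm less than 1 put \<open>R = (1 - z)\<^sup>-\<^sup>1\<close> and \<open>U = 2 R - 1\<close>. Then
  \<open>U\<close> is a unitary, so the averages \<open>F = (1 + U + \<dots> + U\<^sup>N\<^sup>-\<^sup>1) / N\<close> are contractive, while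
  \<open>2 z R F = (U - 1) F = (U\<^sup>N - 1) / N\<close> tends to 0. Thus \<open>x R F\<close> is small, and \<open>1 - R F\<close> lies
  in every ideal containing \<open>x\<close>.
\<close>

section \<open>Algebra and norm\<close>

lemma complex_ring_simps [simp]:
  "carrier complex_ring = UNIV" "a \<otimes>\<^bsub>complex_ring\<^esub> b = a * b" "\<one>\<^bsub>complex_ring\<^esub> = 1"
  "\<zero>\<^bsub>complex_ring\<^esub> = 0" "a \<oplus>\<^bsub>complex_ring\<^esub> b = a + b"
  by (simp_all add: complex_ring_def)

lemma (in Metric_space) closedin_iff_approx:
  "closedin mtopology S \<longleftrightarrow> S \<subseteq> M \<and> (\<forall>x\<in>M. (\<forall>\<epsilon>>0. \<exists>y\<in>S. d x y < \<epsilon>) \<longrightarrow> x \<in> S)"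
  unfolding closedin_metric disjnt_iff by (auto simp: subset_iff) (meson not_less)+

context cstar_algebra
begin

lemma scale_closed [simp, intro]: "x \<in> carrier A \<Longrightarrow> c \<odot> x \<in> carrier A"
  using smult_closed by simp

lemma scale_add_left: "x \<in> carrier A \<Longrightarrow> (c + d) \<odot> x = c \<odot> x \<oplus> d \<odot> x"
  using smult_l_distr[of c d x] by simp

lemma scale_add_right:
  "\<lbrakk>x \<in> carrier A; y \<in> carrier A\<rbrakk> \<Longrightarrow> c \<odot> (x \<oplus> y) = c \<odot> x \<oplus> c \<odot> y"
  using smult_r_distr[of c x y] by simp

lemma scale_scale: "x \<in> carrier A \<Longrightarrow> c \<odot> (d \<odot> x) = (c * d) \<odot> x"
  using smult_assoc1[of c d x] by simp

lemma scale_one [simp]: "x \<in> carrier A \<Longrightarrow> 1 \<odot> x = x"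
  using smult_one[of x] by simp

lemma scale_zero_left [simp]: "x \<in> carrier A \<Longrightarrow> 0 \<odot> x = \<zero>"
  using smult_l_null[of x] by simp

lemma scale_minus_one: "x \<in> carrier A \<Longrightarrow> (- 1) \<odot> x = \<ominus> x"
proof -
  assume x: "x \<in> carrier A"
  have "(- 1) \<odot> x \<oplus> x = (- 1 + 1) \<odot> x"
    using x by (simp only: scale_add_left scale_one)
  then have "(- 1) \<odot> x \<oplus> x = \<zero>" using x by simp
  then show ?thesis using x minus_equality by (metis scale_closed)
qed

lemmas closures [simp] = mult_closed star_closed

lemma mult_zero_right [simp]: "x \<in> carrier A \<Longrightarrow> x \<otimes> \<zero> = \<zero>"
  using smult_mult_right[of x \<zero> 0] by simp

lemma mult_zero_left [simp]: "x \<in> carrier A \<Longrightarrow> \<zero> \<otimes> x = \<zero>"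
  using smult_mult_left[of \<zero> x 0] by simp

lemma mult_minus_right: "\<lbrakk>x \<in> carrier A; y \<in> carrier A\<rbrakk> \<Longrightarrow> x \<otimes> (\<ominus> y) = \<ominus> (x \<otimes> y)"
  using smult_mult_right[of x y "- 1"] by (simp add: scale_minus_one)

lemma mult_minus_left: "\<lbrakk>x \<in> carrier A; y \<in> carrier A\<rbrakk> \<Longrightarrow> (\<ominus> x) \<otimes> y = \<ominus> (x \<otimes> y)"
  using smult_mult_left[of x y "- 1"] by (simp add: scale_minus_one)

lemma minus_swap:
  "\<lbrakk>x = y \<ominus> z; x \<in> carrier A; y \<in> carrier A; z \<in> carrier A\<rbrakk> \<Longrightarrow> z = y \<ominus> x"
  by (simp add: minus_eq minus_add r_neg2)

lemma nrm_zero [simp]: "nrm A \<zero> = 0"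
  by (simp add: nrm_eq_zero_iff)

lemma nrm_uminus: "x \<in> carrier A \<Longrightarrow> nrm A (\<ominus> x) = nrm A x"
  using nrm_smult[of x "- 1"] by (simp add: scale_minus_one)

lemma nrm_minus_commute:
  "\<lbrakk>x \<in> carrier A; y \<in> carrier A\<rbrakk> \<Longrightarrow> nrm A (x \<ominus> y) = nrm A (y \<ominus> x)"
  using nrm_uminus[of "x \<ominus> y"] by (simp add: minus_eq minus_add a_comm)

lemma nrm_minus_triangle:
  "\<lbrakk>x \<in> carrier A; y \<in> carrier A; z \<in> carrier A\<rbrakk>
    \<Longrightarrow> nrm A (x \<ominus> z) \<le> nrm A (x \<ominus> y) + nrm A (y \<ominus> z)"
  using nrm_triangle[of "x \<ominus> y" "y \<ominus> z"]
  by (simp add: minus_eq a_assoc r_neg1)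

lemma nrm_minus_le:
  "\<lbrakk>x \<in> carrier A; y \<in> carrier A\<rbrakk> \<Longrightarrow> nrm A (x \<ominus> y) \<le> nrm A x + nrm A y"
  using nrm_triangle[of x "\<ominus> y"] by (simp add: minus_eq nrm_uminus)

lemma minus_eq_zero_iff: "\<lbrakk>x \<in> carrier A; y \<in> carrier A\<rbrakk> \<Longrightarrow> x \<ominus> y = \<zero> \<longleftrightarrow> x = y"
  using add.inv_solve_right[of \<zero> x y] by (auto simp: minus_eq)

sublocale norm_metric: Metric_space "carrier A" "ndist A"
  by unfold_locales
    (auto simp: ndist_def nrm_nonneg nrm_minus_commute nrm_eq_zero_iff minus_eq_zero_iff
      nrm_minus_triangle)

lemma nrm_star: "x \<in> carrier A \<Longrightarrow> nrm A (star A x) = nrm A x"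
proof -
  have le: "nrm A x \<le> nrm A (star A x)" if x: "x \<in> carrier A" for x
  proof (cases "nrm A x = 0")
    case False
    have "nrm A x * nrm A x \<le> nrm A (star A x) * nrm A x"
      using nrm_star_mult_self[OF x] nrm_mult[of "star A x" x] x by (simp add: power2_eq_square)
    moreover have "0 < nrm A x" using False nrm_nonneg[OF x] by simp
    ultimately show ?thesis by simp
  qed (use x nrm_nonneg[of "star A x"] in simp)
  assume x: "x \<in> carrier A"
  show ?thesis using le[OF x] le[of "star A x"] x by (simp add: star_star)
qed

section \<open>Contractive perturbations of the identity\<close>

text \<open>
  An element \<open>v\<close> stands for the element \<open>1 + v\<close> of the unitization: the condition says that left
  multiplication by \<open>1 + v\<close> is a contraction of \<open>A\<close>. Working with \<open>v\<close> keeps the calculations inside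
  \<open>A\<close>, where \<open>v\<close> can belong to an ideal.
\<close>

definition contractive :: "'a \<Rightarrow> bool" where
  "contractive v \<longleftrightarrow> v \<in> carrier A \<and> (\<forall>a\<in>carrier A. nrm A (a \<oplus> v \<otimes> a) \<le> nrm A a)"

text \<open>
  Applying \<open>1 + v\<close> to \<open>v\<^sup>*\<close> bounds the norm of \<open>v v\<^sup>*\<close>, which is the square of the norm of \<open>v\<close>, by
  twice the norm of \<open>v\<close>.
\<close>

lemma contractive_nrm_le:
  assumes "contractive v"
  shows "nrm A v \<le> 2"
proof -
  have v: "v \<in> carrier A" and vc: "nrm A (star A v \<oplus> v \<otimes> star A v) \<le> nrm A v"
    using assms by (auto simp: contractive_def nrm_star dest!: bspec[where x="star A v"])
  have "v \<otimes> star A v = (star A v \<oplus> v \<otimes> star A v) \<ominus> star A v"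
    using v by (simp add: minus_eq a_comm a_assoc r_neg r_neg1 r_neg2)
  then have "nrm A (v \<otimes> star A v) \<le> nrm A v + nrm A v"
    using vc nrm_minus_le[of "star A v \<oplus> v \<otimes> star A v" "star A v"] v by (simp add: nrm_star)
  moreover have "nrm A (v \<otimes> star A v) = nrm A v * nrm A v"
    using nrm_star_mult_self[of "star A v"] v by (simp add: nrm_star star_star power2_eq_square)
  ultimately have "nrm A v * nrm A v \<le> 2 * nrm A v" by simp
  then show ?thesis using nrm_nonneg[OF v] by (cases "nrm A v = 0") auto
qed

text \<open>
  The hypothesis says \<open>(1 + v)\<^sup>* (1 + v) = 1\<close>, so that \<open>b = (1 + v) a\<close> satisfies \<open>b\<^sup>* b = a\<^sup>* a\<close>.
\<close>

lemma isometric_if_unitary: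
  assumes v: "v \<in> carrier A" and unitary: "v \<oplus> star A v \<oplus> star A v \<otimes> v = \<zero>"
    and a: "a \<in> carrier A"
  shows "nrm A (a \<oplus> v \<otimes> a) = nrm A a"
proof -
  let ?b = "a \<oplus> v \<otimes> a"
  have "star A ?b \<otimes> ?b
      = star A a \<otimes> a \<oplus> star A a \<otimes> ((v \<oplus> star A v \<oplus> star A v \<otimes> v) \<otimes> a)"
    using v a by (simp add: star_add star_mult mult_distrib_left mult_distrib_right
        mult_assoc a_ac)
  also have "\<dots> = star A a \<otimes> a" using a by (simp add: unitary)
  finally have "(nrm A ?b)\<^sup>2 = (nrm A a)\<^sup>2"
    using nrm_star_mult_self[of ?b] nrm_star_mult_self[of a] v a by simp
  then show ?thesis using nrm_nonneg v a by simp
qed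

text \<open>
  The Cayley transform of a skew-adjoint element: \<open>1 + e\<close> is a right inverse of \<open>1 - z\<close>, and
  \<open>1 + 2 e = (1 + z) (1 - z)\<^sup>-\<^sup>1\<close>. A solution of \<open>e = z + z e\<close> exists by Banach's fixed
  point theorem, since left multiplication by \<open>z\<close> is a strict contraction; that \<open>e\<close>
  is expressed through \<open>z\<close> in this way also shows that it lies in every ideal containing \<open>z\<close>.
\<close>

lemma skew_resolvent:
  assumes z: "z \<in> carrier A" and skew: "star A z = \<ominus> z" and small: "nrm A z < 1"
  obtains e where "e \<in> carrier A" "e = z \<oplus> z \<otimes> e"
    "\<And>a. a \<in> carrier A \<Longrightarrow> nrm A (a \<oplus> (e \<oplus> e) \<otimes> a) = nrm A a"
proof -
  let ?f = "\<lambda>e. z \<oplus> z \<otimes> e"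
  have lip: "ndist A (?f x) (?f y) \<le> nrm A z * ndist A x y"
    if x: "x \<in> carrier A" and y: "y \<in> carrier A" for x y
  proof -
    have "?f x \<ominus> ?f y = z \<otimes> (x \<ominus> y)"
      using x y z by (simp add: minus_eq mult_distrib_left mult_minus_right minus_add a_ac r_neg r_neg1 r_neg2)
    then show ?thesis using nrm_mult[of z "x \<ominus> y"] x y z by (simp add: ndist_def)
  qed
  obtain e where e: "e \<in> carrier A" and fix_e: "z \<oplus> z \<otimes> e = e"
    using norm_metric.Banach_fixedpoint_thm[OF complete, of ?f "nrm A z"] lip small z by auto
  have "star A e = star A (z \<oplus> z \<otimes> e)" by (simp add: fix_e)
  then have star_e: "star A e = \<ominus> z \<oplus> star A e \<otimes> \<ominus> z"
    using e z by (simp add: star_add star_mult skew)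
  \<comment> \<open>The adjoint of the equation for \<open>e\<close> expresses \<open>e\<^sup>* z\<close> linearly; inserting it into
    \<open>e\<^sup>* e = e\<^sup>* z + e\<^sup>* z e\<close> gives the unitarity relation \<open>2 e\<^sup>* e + e + e\<^sup>* = 0\<close>.\<close>
  have mz: "star A e \<otimes> z = \<ominus> z \<ominus> star A e"
  proof -
    have "star A e = \<ominus> z \<ominus> star A e \<otimes> z"
      using star_e e z by (simp add: mult_minus_right minus_eq)
    then show ?thesis by (rule minus_swap) (use e z in simp_all)
  qed
  have dbl: "star A e \<otimes> e \<oplus> star A e \<otimes> e \<oplus> e \<oplus> star A e = \<zero>"
  proof -
    have "star A e \<otimes> e = star A e \<otimes> (z \<oplus> z \<otimes> e)" by (simp add: fix_e)
    also have "\<dots> = (\<ominus> z \<ominus> star A e) \<oplus> (\<ominus> z \<ominus> star A e) \<otimes> e"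
      using e z by (simp add: mult_distrib_left mult_assoc[symmetric] mz)
    also have "\<dots> = \<ominus> (z \<oplus> z \<otimes> e) \<ominus> star A e \<ominus> star A e \<otimes> e"
      using e z by (simp add: minus_eq mult_distrib_right mult_minus_left minus_add a_ac)
    finally have "star A e \<otimes> e = \<ominus> (star A e \<otimes> e \<oplus> e \<oplus> star A e)"
      using e by (simp add: fix_e minus_eq minus_add a_ac)
    then have "star A e \<otimes> e \<oplus> (star A e \<otimes> e \<oplus> e \<oplus> star A e) = \<zero>"
      using e by (metis l_neg a_closed closures)
    then show ?thesis using e by (simp add: a_assoc)
  qed
  have "(e \<oplus> e) \<oplus> star A (e \<oplus> e) \<oplus> star A (e \<oplus> e) \<otimes> (e \<oplus> e)
     = (star A e \<otimes> e \<oplus> star A e \<otimes> e \<oplus> e \<oplus> star A e)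
       \<oplus> (star A e \<otimes> e \<oplus> star A e \<otimes> e \<oplus> e \<oplus> star A e)"
    using e by (simp add: star_add mult_distrib_left mult_distrib_right a_ac)
  also have "\<dots> = \<zero>" by (simp add: dbl)
  finally have "nrm A (a \<oplus> (e \<oplus> e) \<otimes> a) = nrm A a" if "a \<in> carrier A" for a
    using isometric_if_unitary[of "e \<oplus> e"] e that by simp
  then show thesis using that[OF e fix_e[symmetric]] by blast
qed


section \<open>Bounded approximate units in closed ideals\<close>

lemma closed_idealD:
  assumes "closed_ideal I A"
  shows "I \<subseteq> carrier A" "\<zero> \<in> I"
    "\<And>x y. \<lbrakk>x \<in> I; y \<in> I\<rbrakk> \<Longrightarrow> x \<oplus> y \<in> I" "\<And>x. x \<in> I \<Longrightarrow> \<ominus> x \<in> I"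
    "\<And>x c. x \<in> I \<Longrightarrow> c \<odot> x \<in> I"
    "\<And>a x. \<lbrakk>a \<in> carrier A; x \<in> I\<rbrakk> \<Longrightarrow> a \<otimes> x \<in> I"
    "\<And>a x. \<lbrakk>a \<in> carrier A; x \<in> I\<rbrakk> \<Longrightarrow> x \<otimes> a \<in> I"
    "closedin norm_metric.mtopology I"
proof -
  have sub: "submodule I complex_ring A" using assms by (simp add: closed_ideal_def)
  show "\<zero> \<in> I" using subgroup.one_closed[OF submodule.axioms(1)[OF sub]] by simp
  show "I \<subseteq> carrier A" "\<And>x y. \<lbrakk>x \<in> I; y \<in> I\<rbrakk> \<Longrightarrow> x \<oplus> y \<in> I" "\<And>x. x \<in> I \<Longrightarrow> \<ominus> x \<in> I"
    "\<And>x c. x \<in> I \<Longrightarrow> c \<odot> x \<in> I"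
    using submoduleE[OF sub] by auto
qed (use assms in \<open>auto simp: closed_ideal_def norm_topology_def\<close>)

text \<open>
  With \<open>U = 1 + v\<close>, the witnesses are \<open>p = U\<^sup>N - 1\<close> and \<open>s = 1 + U + \<dots> + U\<^sup>N\<^sup>-\<^sup>1 - N\<close>. The bound on
  \<open>N + s\<close> is the triangle inequality for a sum of \<open>N\<close> contractions, and the last identity is the
  geometric sum \<open>(U - 1) (N + s) = U\<^sup>N - 1\<close>.
\<close>

lemma cesaro_partial_sums:
  assumes "closed_ideal I A" and "v \<in> I" and v: "contractive v"
  shows "\<exists>p\<in>I. \<exists>s\<in>I. contractive p
      \<and> (\<forall>a\<in>carrier A. nrm A (of_nat N \<odot> a \<oplus> s \<otimes> a) \<le> real N * nrm A a)
      \<and> of_nat N \<odot> v \<oplus> v \<otimes> s = p"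
proof (induction N)
  note I = \<open>v \<in> I\<close> closed_idealD(1-3,6)[OF assms(1)]
  case 0
  have "contractive \<zero>" by (simp add: contractive_def)
  then show ?case using I(1,2)
    by (intro bexI[OF _ I(3)]) (auto simp: subset_iff)
next
  note I = \<open>v \<in> I\<close> closed_idealD(1-3,6)[OF assms(1)]
  case (Suc N)
  then obtain p s where p: "p \<in> I" "contractive p" and s: "s \<in> I"
    and bound: "\<And>a. a \<in> carrier A \<Longrightarrow> nrm A (of_nat N \<odot> a \<oplus> s \<otimes> a) \<le> real N * nrm A a"
    and sum: "of_nat N \<odot> v \<oplus> v \<otimes> s = p" by fast
  have c: "v \<in> carrier A" "p \<in> carrier A" "s \<in> carrier A" using I p s by auto
  let ?p = "v \<oplus> p \<oplus> v \<otimes> p"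
  have "nrm A (a \<oplus> ?p \<otimes> a) \<le> nrm A a" if a: "a \<in> carrier A" for a
  proof -
    have "a \<oplus> ?p \<otimes> a = (a \<oplus> p \<otimes> a) \<oplus> v \<otimes> (a \<oplus> p \<otimes> a)"
      using a c by (simp add: mult_distrib_left mult_distrib_right mult_assoc a_ac)
    then have "nrm A (a \<oplus> ?p \<otimes> a) \<le> nrm A (a \<oplus> p \<otimes> a)"
      using v a c by (simp add: contractive_def)
    also have "\<dots> \<le> nrm A a" using p a by (simp add: contractive_def)
    finally show ?thesis .
  qed
  then have "contractive ?p" using c by (simp add: contractive_def)
  moreover have "nrm A (of_nat (Suc N) \<odot> a \<oplus> (s \<oplus> p) \<otimes> a) \<le> real (Suc N) * nrm A a"
    if a: "a \<in> carrier A" for a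
  proof -
    have "of_nat (Suc N) \<odot> a \<oplus> (s \<oplus> p) \<otimes> a
        = (of_nat N \<odot> a \<oplus> s \<otimes> a) \<oplus> (a \<oplus> p \<otimes> a)"
      using a c by (simp add: scale_add_left mult_distrib_right a_ac)
    also have "nrm A \<dots> \<le> real N * nrm A a + nrm A a"
      using nrm_triangle[of "of_nat N \<odot> a \<oplus> s \<otimes> a" "a \<oplus> p \<otimes> a"] bound[OF a] p a c
      by (fastforce simp: contractive_def)
    finally show ?thesis by (simp add: algebra_simps)
  qed
  moreover have "of_nat (Suc N) \<odot> v \<oplus> v \<otimes> (s \<oplus> p) = ?p"
  proof -
    have "of_nat (Suc N) \<odot> v \<oplus> v \<otimes> (s \<oplus> p) = v \<oplus> (of_nat N \<odot> v \<oplus> v \<otimes> s) \<oplus> v \<otimes> p"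
      using c by (simp add: scale_add_left mult_distrib_left a_ac)
    then show ?thesis by (simp add: sum)
  qed
  moreover have "?p \<in> I" "s \<oplus> p \<in> I" using I p s c by auto
  ultimately show ?case by blast
qed

text \<open>
  Here \<open>-w\<close> is the approximate unit, and its norm is bounded by a constant that does not
  depend on \<open>x\<close> and \<open>\<epsilon>\<close>. The element \<open>1 + w\<close> is \<open>R F\<close>, the product of the resolvent \<open>R = 1 + e\<close>
  of a small skew-adjoint multiple \<open>z\<close> of \<open>h = x\<^sup>* x\<close> and an average \<open>F = 1 + f\<close> of \<open>N\<close> powers of the
  Cayley transform of \<open>z\<close>. Making \<open>h (1 + w)\<close> small is enough because the square of the norm of
  \<open>x (1 + w)\<close> is the norm of \<open>(1 + w)\<^sup>* h (1 + w)\<close>.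
\<close>

lemma bounded_right_approximate_unit:
  assumes "closed_ideal I A" and x: "x \<in> I" and "0 < \<epsilon>"
  obtains w where "w \<in> I" "nrm A w \<le> 2" "nrm A (x \<oplus> x \<otimes> w) \<le> \<epsilon>"
proof -
  note I = closed_idealD[OF assms(1)]
  have xc: "x \<in> carrier A" using I(1) x by auto
  define h where "h = star A x \<otimes> x"
  \<comment> \<open>The factor \<open>c\<close> brings the norm of \<open>z\<close> below 1.\<close>
  define c where "c = 1 / (nrm A h + 1)"
  define z where "z = (\<i> * of_real c) \<odot> h"
  have h: "h \<in> I" "h \<in> carrier A" "star A h = h"
    using x xc I by (auto simp: h_def star_mult star_star)
  have c: "0 < c" using nrm_nonneg[OF h(2)] by (simp add: c_def)
  have z: "z \<in> I" "z \<in> carrier A" using h I by (auto simp: z_def)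
  have "star A z = (- 1) \<odot> z" using h by (simp add: z_def star_smult scale_scale)
  then have skew: "star A z = \<ominus> z" using z by (simp add: scale_minus_one)
  have "nrm A z = c * nrm A h"
    using nrm_smult[OF h(2)] c by (simp add: z_def norm_mult)
  also have "\<dots> < 1" using nrm_nonneg[OF h(2)] by (simp add: c_def)
  finally obtain e where e: "e \<in> carrier A" and fix_e: "e = z \<oplus> z \<otimes> e"
    and iso: "\<And>a. a \<in> carrier A \<Longrightarrow> nrm A (a \<oplus> (e \<oplus> e) \<otimes> a) = nrm A a"
    using skew_resolvent[OF z(2) skew] by blast
  have eI: "e \<in> I"
    by (subst fix_e) (rule I(3)[OF z(1) I(7)[OF e z(1)]])
  let ?v = "e \<oplus> e"
  have v: "contractive ?v" using iso e by (simp add: contractive_def)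
  \<comment> \<open>The final estimate will be that the square of the norm of \<open>x (1 + w)\<close> is at most \<open>3 / (c N)\<close>.\<close>
  obtain N :: nat where N: "3 / (c * \<epsilon>\<^sup>2) < real N" using reals_Archimedean2 by blast
  moreover have "0 < 3 / (c * \<epsilon>\<^sup>2)" using c \<open>0 < \<epsilon>\<close> by simp
  ultimately have Npos: "0 < real N" by linarith
  obtain p s where p: "p \<in> I" "contractive p" and s: "s \<in> I"
    and bound: "\<And>a. a \<in> carrier A \<Longrightarrow> nrm A (of_nat N \<odot> a \<oplus> s \<otimes> a) \<le> real N * nrm A a"
    and sum: "of_nat N \<odot> ?v \<oplus> ?v \<otimes> s = p"
    using cesaro_partial_sums[OF assms(1) I(3)[OF eI eI] v, of N] by fast
  define f where "f = of_real (1 / N) \<odot> s"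
  have f: "f \<in> I" "f \<in> carrier A" using s I by (auto simp: f_def)
  have sc: "s \<in> carrier A" "p \<in> carrier A" using s p I by auto
  have f_contr: "nrm A (a \<oplus> f \<otimes> a) \<le> nrm A a" if a: "a \<in> carrier A" for a
  proof -
    have "a \<oplus> f \<otimes> a = of_real (1 / N) \<odot> (of_nat N \<odot> a \<oplus> s \<otimes> a)"
      using a sc Npos by (simp add: f_def scale_add_right scale_scale smult_mult_left)
    then have "nrm A (a \<oplus> f \<otimes> a) = nrm A (of_nat N \<odot> a \<oplus> s \<otimes> a) / N"
      using a sc by (simp add: nrm_smult norm_divide)
    then show ?thesis using bound[OF a] Npos by (simp add: divide_le_eq mult.commute)
  qed
  define w where "w = e \<oplus> f \<oplus> e \<otimes> f"
  have w: "w \<in> I" "w \<in> carrier A" using eI e f I by (auto simp: w_def)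
  have "nrm A (a \<oplus> w \<otimes> a) \<le> nrm A a" if a: "a \<in> carrier A" for a
  proof -
    \<comment> \<open>\<open>R\<close> is the mean of the contractions \<open>1\<close> and \<open>U = 1 + 2 e\<close>; it is applied to \<open>b = F a\<close>.\<close>
    let ?b = "a \<oplus> f \<otimes> a"
    have b: "?b \<in> carrier A" using a f by simp
    have "2 \<odot> (a \<oplus> w \<otimes> a) = (a \<oplus> w \<otimes> a) \<oplus> (a \<oplus> w \<otimes> a)"
      using scale_add_left[of "a \<oplus> w \<otimes> a" 1 1] a w by simp
    also have "\<dots> = ?b \<oplus> (?b \<oplus> ?v \<otimes> ?b)"
      using a e f by (simp add: w_def mult_distrib_left mult_distrib_right mult_assoc a_ac)
    finally have "2 * nrm A (a \<oplus> w \<otimes> a) = nrm A (?b \<oplus> (?b \<oplus> ?v \<otimes> ?b))"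
      using nrm_smult[of "a \<oplus> w \<otimes> a" 2] a w by simp
    also have "\<dots> \<le> nrm A ?b + nrm A ?b"
      using nrm_triangle[of ?b "?b \<oplus> ?v \<otimes> ?b"] b e iso[OF b] by simp
    finally show ?thesis using f_contr[OF a] by linarith
  qed
  then have w2: "nrm A w \<le> 2" using contractive_nrm_le w by (simp add: contractive_def)
  have zw: "nrm A (z \<oplus> z \<otimes> w) \<le> 1 / N"
  proof -
    \<comment> \<open>Since \<open>z R = e\<close>, the element \<open>2 N z R F\<close> equals \<open>(U - 1) (N F) = U\<^sup>N - 1\<close>, of norm at most 2.\<close>
    have "z \<oplus> z \<otimes> w = (z \<oplus> z \<otimes> e) \<oplus> (z \<oplus> z \<otimes> e) \<otimes> f"
      using z e f by (simp add: w_def mult_distrib_left mult_distrib_right mult_assoc a_ac)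
    then have zw_eq: "z \<oplus> z \<otimes> w = e \<oplus> e \<otimes> f" by (simp add: fix_e[symmetric])
    have "of_real (2 * N) \<odot> (e \<oplus> e \<otimes> f) = of_nat N \<odot> (2 \<odot> (e \<oplus> e \<otimes> f))"
      using e f by (simp add: scale_scale mult.commute)
    also have "2 \<odot> (e \<oplus> e \<otimes> f) = (e \<oplus> e \<otimes> f) \<oplus> (e \<oplus> e \<otimes> f)"
      using scale_add_left[of "e \<oplus> e \<otimes> f" 1 1] e f by simp
    also have "\<dots> = ?v \<oplus> ?v \<otimes> f"
      using e f by (simp add: mult_distrib_right a_ac)
    also have "of_nat N \<odot> \<dots> = of_nat N \<odot> ?v \<oplus> ?v \<otimes> s"
      using e sc Npos by (simp add: f_def scale_add_right smult_mult_right scale_scale)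
    finally have "2 * N * nrm A (e \<oplus> e \<otimes> f) = nrm A p"
      using nrm_smult[of "e \<oplus> e \<otimes> f" "of_real (2 * N)"] e f sum by (simp add: norm_mult)
    then have "2 * N * nrm A (z \<oplus> z \<otimes> w) \<le> 2"
      using contractive_nrm_le[OF p(2)] by (simp add: zw_eq)
    then show ?thesis using Npos by (simp add: field_simps)
  qed
  have hw: "nrm A (h \<oplus> h \<otimes> w) \<le> 1 / (c * N)"
  proof -
    have "z \<oplus> z \<otimes> w = (\<i> * of_real c) \<odot> (h \<oplus> h \<otimes> w)"
      using h w by (simp add: z_def scale_add_right smult_mult_left)
    then have "nrm A (z \<oplus> z \<otimes> w) = c * nrm A (h \<oplus> h \<otimes> w)"
      using h w c by (simp add: nrm_smult norm_mult)
    then show ?thesis using zw c Npos by (simp add: field_simps)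
  qed
  let ?y = "h \<oplus> h \<otimes> w"
  have "star A (x \<oplus> x \<otimes> w) \<otimes> (x \<oplus> x \<otimes> w) = ?y \<oplus> star A w \<otimes> ?y"
    using xc w by (simp add: h_def star_add star_mult mult_distrib_left mult_distrib_right mult_assoc a_ac)
  then have "(nrm A (x \<oplus> x \<otimes> w))\<^sup>2 = nrm A (?y \<oplus> star A w \<otimes> ?y)"
    using nrm_star_mult_self[of "x \<oplus> x \<otimes> w"] xc w by simp
  also have "\<dots> \<le> nrm A ?y + nrm A w * nrm A ?y"
    using nrm_triangle[of ?y "star A w \<otimes> ?y"] nrm_mult[of "star A w" ?y] h w
    by (simp add: nrm_star)
  also have "\<dots> \<le> nrm A ?y + 2 * nrm A ?y"
    using w2 nrm_nonneg[of ?y] h w by (simp add: mult_right_mono)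
  also have "\<dots> \<le> 3 / (c * N)" using hw by simp
  also have "\<dots> \<le> \<epsilon>\<^sup>2" using N Npos c \<open>0 < \<epsilon>\<close> by (simp add: field_simps)
  finally have "nrm A (x \<oplus> x \<otimes> w) \<le> \<epsilon>"
    by (rule power2_le_imp_le) (use \<open>0 < \<epsilon>\<close> in simp)
  then show thesis using that[OF w(1) w2] by simp
qed


section \<open>Sums of closed ideals\<close>

lemma set_add_iff: "x \<in> I <+>\<^bsub>A\<^esub> J \<longleftrightarrow> (\<exists>i\<in>I. \<exists>j\<in>J. x = i \<oplus> j)"
  by (auto simp: set_add_def set_mult_def)

text \<open>
  This is openness of the addition map from \<open>I \<times> J\<close> onto \<open>I + J\<close>. For an approximate unit \<open>-w\<close>
  of \<open>i\<close>, the summand \<open>i' = i (1 + w) - (i + j) w\<close> still differs from \<open>i\<close> by the element \<open>j w\<close> of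
  \<open>I \<inter> J\<close>, and the norms of both of its terms are at most a multiple of that of \<open>i + j\<close>: for the
  first one the precision of the approximate unit is chosen to be the norm of \<open>i + j\<close>.
\<close>

lemma bounded_decomposition:
  assumes I: "closed_ideal I A" and J: "closed_ideal J A" and i: "i \<in> I" and j: "j \<in> J"
  obtains i' j' where "i' \<in> I" "j' \<in> J" "i' \<oplus> j' = i \<oplus> j" "nrm A i' \<le> 3 * nrm A (i \<oplus> j)"
proof (cases "i \<oplus> j = \<zero>")
  case True
  then show ?thesis using that[of \<zero> \<zero>] closed_idealD(2)[OF I] closed_idealD(2)[OF J] by simp
next
  case False
  note I' = closed_idealD[OF I] and J' = closed_idealD[OF J]
  have c: "i \<in> carrier A" "j \<in> carrier A" using i j I' J' by auto
  let ?y = "i \<oplus> j"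
  have y: "0 < nrm A ?y" using False c nrm_nonneg[of ?y] nrm_eq_zero_iff[of ?y] by simp
  obtain w where w: "w \<in> I" "nrm A w \<le> 2" "nrm A (i \<oplus> i \<otimes> w) \<le> nrm A ?y"
    using bounded_right_approximate_unit[OF I i y] .
  have wc: "w \<in> carrier A" using w I' by auto
  let ?i = "(i \<oplus> i \<otimes> w) \<ominus> ?y \<otimes> w"
  have "?i \<in> I" using I' i w c wc unfolding minus_eq by simp
  moreover have "j \<oplus> j \<otimes> w \<in> J" using J' j wc by simp
  moreover have "?i \<oplus> (j \<oplus> j \<otimes> w) = ?y"
    using c wc by (simp add: minus_eq mult_distrib_right minus_add a_ac r_neg r_neg1 r_neg2)
  moreover have "nrm A ?i \<le> 3 * nrm A ?y"
  proof -
    have "nrm A ?i \<le> nrm A (i \<oplus> i \<otimes> w) + nrm A ?y * nrm A w"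
      using nrm_minus_le[of "i \<oplus> i \<otimes> w" "?y \<otimes> w"] nrm_mult[of ?y w] c wc by simp
    also have "\<dots> \<le> nrm A ?y + nrm A ?y * 2"
      using w y by (intro add_mono mult_left_mono) auto
    finally show ?thesis by simp
  qed
  ultimately show ?thesis using that by blast
qed

lemma norm_closedin_iff:
  "closedin (norm_topology A) S \<longleftrightarrow>
    S \<subseteq> carrier A \<and> (\<forall>x\<in>carrier A. (\<forall>\<epsilon>>0. \<exists>y\<in>S. nrm A (x \<ominus> y) < \<epsilon>) \<longrightarrow> x \<in> S)"
  unfolding norm_topology_def norm_metric.closedin_iff_approx
  by (rule conj_cong[OF refl] ball_cong[OF refl])+ (auto simp: ndist_def subset_iff)

lemma geometric_steps_converge:
  assumes p: "\<And>n. p n \<in> carrier A" and step: "\<And>n. nrm A (p n \<ominus> p (Suc n)) \<le> C / 2 ^ n"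
  obtains l where "l \<in> carrier A" "\<And>\<epsilon>. 0 < \<epsilon> \<Longrightarrow> \<exists>N. \<forall>n\<ge>N. nrm A (p n \<ominus> l) < \<epsilon>"
proof -
  have C: "0 \<le> C" using step[of 0] nrm_nonneg[of "p 0 \<ominus> p (Suc 0)"] p by simp
  have d: "nrm A (p m \<ominus> p (m + k)) \<le> 2 * C / 2 ^ m * (1 - 1 / 2 ^ k)" for m k
  proof (induction k)
    case 0
    then show ?case using p by (simp add: minus_eq r_neg)
  next
    case (Suc k)
    have "nrm A (p m \<ominus> p (m + Suc k)) \<le> nrm A (p m \<ominus> p (m + k)) + C / 2 ^ (m + k)"
      using nrm_minus_triangle[of "p m" "p (m + k)" "p (m + Suc k)"] step[of "m + k"] p by simp
    also have "\<dots> \<le> 2 * C / 2 ^ m * (1 - 1 / 2 ^ k) + C / 2 ^ (m + k)" using Suc by simp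
    also have "\<dots> = 2 * C / 2 ^ m * (1 - 1 / 2 ^ Suc k)"
      by (simp add: field_simps power_add)
    finally show ?case .
  qed
  have tail: "ndist A (p m) (p n) \<le> 2 * C / 2 ^ N" if "N \<le> m" "m \<le> n" for m n N
  proof -
    have "ndist A (p m) (p n) \<le> 2 * C / 2 ^ m * (1 - 1 / 2 ^ (n - m))"
      using d[of m "n - m"] that p by (simp add: ndist_def)
    also have "\<dots> \<le> 2 * C / 2 ^ m * 1" using C by (intro mult_left_mono) auto
    also have "\<dots> \<le> 2 * C / 2 ^ N" using C that by (simp add: frac_le)
    finally show ?thesis .
  qed
  have "norm_metric.MCauchy p"
    unfolding norm_metric.MCauchy_def
  proof (intro conjI allI impI)
    fix \<epsilon> :: real assume "0 < \<epsilon>"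
    obtain N where "2 * C / \<epsilon> < 2 ^ N" using real_arch_pow[of 2 "2 * C / \<epsilon>"] by auto
    then have N: "2 * C / 2 ^ N < \<epsilon>" using \<open>0 < \<epsilon>\<close> by (simp add: field_simps)
    have "ndist A (p n) (p n') < \<epsilon>" if "N \<le> n" "N \<le> n'" for n n'
      using tail[of N n n'] tail[of N n' n] that N norm_metric.commute[of "p n" "p n'"]
      by (cases "n \<le> n'") auto
    then show "\<exists>N. \<forall>n n'. N \<le> n \<longrightarrow> N \<le> n' \<longrightarrow> ndist A (p n) (p n') < \<epsilon>" by blast
  qed (use p in auto)
  then obtain l where "limitin norm_metric.mtopology p l sequentially"
    using complete unfolding norm_metric.mcomplete_def by blast
  then have l: "l \<in> carrier A" "\<And>\<epsilon>. 0 < \<epsilon> \<Longrightarrow> \<exists>N. \<forall>n\<ge>N. ndist A (p n) l < \<epsilon>"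
    unfolding norm_metric.limit_metric_sequentially by blast+
  then show thesis using that[of l] p by (simp add: ndist_def)
qed

lemma submodule_of_ideal: "closed_ideal I A \<Longrightarrow> submodule I complex_ring A"
  by (simp add: closed_ideal_def)

text \<open>
  A limit \<open>x\<close> of the sum is approximated by \<open>p n + q n\<close> up to \<open>1 / 2 ^ n\<close>. The increments of
  \<open>p n + q n\<close> lie in the sum and are of order \<open>1 / 2 ^ n\<close>, so that by the bounded
  decomposition the increments of \<open>p n\<close> can be chosen to be of this order as well. Then \<open>p n\<close>
  converges to some \<open>l\<close> in the first ideal, and \<open>q n\<close> to \<open>x - l\<close> in the second.
\<close>

theorem closed_ideal_set_add:
  assumes I: "closed_ideal I A" and J: "closed_ideal J A"
  shows "closed_ideal (I <+>\<^bsub>A\<^esub> J) A"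
proof -
  note I' = closed_idealD[OF I] and J' = closed_idealD[OF J]
  have sub: "I <+>\<^bsub>A\<^esub> J \<subseteq> carrier A" using I'(1) J'(1) by (rule set_add_closed)
  have "submodule (I <+>\<^bsub>A\<^esub> J) complex_ring A"
  proof (rule submoduleI)
    show "\<zero> \<in> I <+>\<^bsub>A\<^esub> J" using I'(2) J'(2) by (force simp: set_add_iff)
  next
    fix x assume "x \<in> I <+>\<^bsub>A\<^esub> J"
    then obtain i j where ij: "i \<in> I" "j \<in> J" "x = i \<oplus> j" by (auto simp: set_add_iff)
    then have c: "i \<in> carrier A" "j \<in> carrier A" using I' J' by auto
    have "\<ominus> x = \<ominus> i \<oplus> \<ominus> j" using ij c by (simp add: minus_add)
    then show "\<ominus> x \<in> I <+>\<^bsub>A\<^esub> J" using ij I'(4) J'(4) unfolding set_add_iff by blast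
    fix a :: complex
    have "a \<odot> x = a \<odot> i \<oplus> a \<odot> j" using ij c by (simp add: scale_add_right)
    then show "a \<odot> x \<in> I <+>\<^bsub>A\<^esub> J" using ij I'(5) J'(5) unfolding set_add_iff by blast
  next
    fix x y assume "x \<in> I <+>\<^bsub>A\<^esub> J" "y \<in> I <+>\<^bsub>A\<^esub> J"
    then obtain i j i' j' where ij: "i \<in> I" "j \<in> J" "x = i \<oplus> j" "i' \<in> I" "j' \<in> J" "y = i' \<oplus> j'"
      by (auto simp: set_add_iff)
    then have c: "i \<in> carrier A" "j \<in> carrier A" "i' \<in> carrier A" "j' \<in> carrier A" using I' J' by auto
    have "x \<oplus> y = (i \<oplus> i') \<oplus> (j \<oplus> j')" using ij c by (simp add: a_ac)
    then show "x \<oplus> y \<in> I <+>\<^bsub>A\<^esub> J" using ij I'(3) J'(3) unfolding set_add_iff by blast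
  qed (use sub in auto)
  moreover have "a \<otimes> x \<in> I <+>\<^bsub>A\<^esub> J \<and> x \<otimes> a \<in> I <+>\<^bsub>A\<^esub> J" if a: "a \<in> carrier A" and x: "x \<in> I <+>\<^bsub>A\<^esub> J" for a x
  proof -
    obtain i j where ij: "i \<in> I" "j \<in> J" "x = i \<oplus> j" using x by (auto simp: set_add_iff)
    then have c: "i \<in> carrier A" "j \<in> carrier A" using I' J' by auto
    have "a \<otimes> x = a \<otimes> i \<oplus> a \<otimes> j" "x \<otimes> a = i \<otimes> a \<oplus> j \<otimes> a"
      using ij c a by (simp_all add: mult_distrib_left mult_distrib_right)
    then show ?thesis using a ij I'(6,7) J'(6,7) unfolding set_add_iff by blast
  qed
  moreover have "closedin (norm_topology A) (I <+>\<^bsub>A\<^esub> J)"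
    unfolding norm_closedin_iff
  proof (intro conjI sub ballI impI)
    fix x assume x: "x \<in> carrier A" and approx: "\<forall>\<epsilon>>0. \<exists>y\<in>I <+>\<^bsub>A\<^esub> J. nrm A (x \<ominus> y) < \<epsilon>"
    let ?P = "\<lambda>n (p, q). p \<in> I \<and> q \<in> J \<and> nrm A (x \<ominus> (p \<oplus> q)) < 1 / 2 ^ n"
    have appr: "\<exists>p\<in>I. \<exists>q\<in>J. nrm A (x \<ominus> (p \<oplus> q)) < 1 / 2 ^ n" for n
    proof -
      obtain y where "y \<in> I <+>\<^bsub>A\<^esub> J" "nrm A (x \<ominus> y) < 1 / 2 ^ n"
        using approx[rule_format, of "1 / 2 ^ n"] by auto
      then show ?thesis unfolding set_add_iff by blast
    qed
    have "\<exists>f. \<forall>n. ?P n (f n) \<and> nrm A (fst (f n) \<ominus> fst (f (Suc n))) \<le> 6 / 2 ^ n"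
    proof (rule dependent_nat_choice)
      show "\<exists>pq. ?P 0 pq" using appr[of 0] by blast
    next
      fix pq n assume pq: "?P n pq"
      obtain p q where [simp]: "pq = (p, q)" by (cases pq)
      have p: "p \<in> I" and q: "q \<in> J" and pqn: "nrm A (x \<ominus> (p \<oplus> q)) < 1 / 2 ^ n" using pq by auto
      obtain i j where i: "i \<in> I" and j: "j \<in> J" and ijn: "nrm A (x \<ominus> (i \<oplus> j)) < 1 / 2 ^ Suc n"
        using appr[of "Suc n"] by blast
      have c: "p \<in> carrier A" "q \<in> carrier A" "i \<in> carrier A" "j \<in> carrier A"
        using p q i j I'(1) J'(1) by auto
      have "i \<ominus> p \<in> I" "j \<ominus> q \<in> J" using p q i j I'(3,4) J'(3,4) by (auto simp: minus_eq)
      then obtain i' j' where i': "i' \<in> I" and j': "j' \<in> J"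
        and sum: "i' \<oplus> j' = (i \<ominus> p) \<oplus> (j \<ominus> q)" and bd: "nrm A i' \<le> 3 * nrm A ((i \<ominus> p) \<oplus> (j \<ominus> q))"
        using bounded_decomposition[OF I J] by metis
      have c': "i' \<in> carrier A" "j' \<in> carrier A" using i' j' I'(1) J'(1) by auto
      have "(i \<ominus> p) \<oplus> (j \<ominus> q) = (i \<oplus> j) \<ominus> (p \<oplus> q)"
        using c by (simp add: minus_eq minus_add a_ac)
      then have "nrm A i' \<le> 3 * (nrm A (x \<ominus> (i \<oplus> j)) + nrm A (x \<ominus> (p \<oplus> q)))"
        using bd nrm_minus_triangle[of "i \<oplus> j" x "p \<oplus> q"] nrm_minus_commute[of x "i \<oplus> j"] c x by simp
      also have "\<dots> \<le> 3 * (1 / 2 ^ n + 1 / 2 ^ n)"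
      proof -
        have "(1 :: real) / 2 ^ Suc n \<le> 1 / 2 ^ n" by (simp add: field_simps)
        then show ?thesis using ijn pqn by (intro mult_left_mono add_mono) linarith+
      qed
      also have "\<dots> = 6 / 2 ^ n" by simp
      finally have i'n: "nrm A i' \<le> 6 / 2 ^ n" .
      have "p \<ominus> (p \<oplus> i') = \<ominus> i'"
        using c c' by (simp add: minus_eq minus_add r_neg2)
      then have "nrm A (p \<ominus> (p \<oplus> i')) \<le> 6 / 2 ^ n" using i'n c' by (simp add: nrm_uminus)
      moreover have "(p \<oplus> i') \<oplus> (q \<oplus> j') = i \<oplus> j"
      proof -
        have "(p \<oplus> i') \<oplus> (q \<oplus> j') = (p \<oplus> q) \<oplus> (i' \<oplus> j')" using c c' by (simp add: a_ac)
        also have "\<dots> = i \<oplus> j" using c by (simp add: sum minus_eq a_ac r_neg r_neg1 r_neg2)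
        finally show ?thesis .
      qed
      moreover have "p \<oplus> i' \<in> I" "q \<oplus> j' \<in> J" using p q i' j' I'(3) J'(3) by auto
      ultimately have "?P (Suc n) (p \<oplus> i', q \<oplus> j')
          \<and> nrm A (fst pq \<ominus> fst (p \<oplus> i', q \<oplus> j')) \<le> 6 / 2 ^ n"
        using ijn by simp
      then show "\<exists>pq'. ?P (Suc n) pq' \<and> nrm A (fst pq \<ominus> fst pq') \<le> 6 / 2 ^ n" by blast
    qed
    then obtain f
      where f: "\<forall>n. ?P n (f n) \<and> nrm A (fst (f n) \<ominus> fst (f (Suc n))) \<le> 6 / 2 ^ n" ..
    define p q where "p n = fst (f n)" and "q n = snd (f n)" for n
    have p: "p n \<in> I" and q: "q n \<in> J" and pq: "nrm A (x \<ominus> (p n \<oplus> q n)) < 1 / 2 ^ n" for n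
      using f[rule_format, of n] by (auto simp: p_def q_def split: prod.splits)
    have c: "p n \<in> carrier A" "q n \<in> carrier A" for n using p q I'(1) J'(1) by auto
    have "nrm A (p n \<ominus> p (Suc n)) \<le> 6 / 2 ^ n" for n
      using f[rule_format, of n] by (simp add: p_def)
    from geometric_steps_converge[OF c(1) this]
    obtain l where l: "l \<in> carrier A"
      and lim: "\<And>\<epsilon>. 0 < \<epsilon> \<Longrightarrow> \<exists>N. \<forall>n\<ge>N. nrm A (p n \<ominus> l) < \<epsilon>" by blast
    have "l \<in> I"
    proof -
      have "\<exists>y\<in>I. nrm A (l \<ominus> y) < \<epsilon>" if "0 < \<epsilon>" for \<epsilon>
        using lim[OF that] p nrm_minus_commute[OF l c(1)] by (metis order_refl)
      then show ?thesis using I l unfolding closed_ideal_def norm_closedin_iff by blast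
    qed
    moreover have "x \<ominus> l \<in> J"
    proof -
      have "\<exists>y\<in>J. nrm A (x \<ominus> l \<ominus> y) < \<epsilon>" if \<epsilon>: "0 < \<epsilon>" for \<epsilon>
      proof -
        obtain N where N: "\<And>n. N \<le> n \<Longrightarrow> nrm A (p n \<ominus> l) < \<epsilon> / 2"
          using lim[of "\<epsilon> / 2"] \<epsilon> by auto
        obtain M where "(1 / 2) ^ M < \<epsilon> / 2" using real_arch_pow_inv[of "\<epsilon> / 2" "1 / 2"] \<epsilon> by auto
        moreover define n where "n = max M N"
        moreover have "(1 / 2 :: real) ^ n \<le> (1 / 2) ^ M" by (rule power_decreasing) (auto simp: n_def)
        ultimately have n: "nrm A (x \<ominus> (p n \<oplus> q n)) < \<epsilon> / 2"
          using pq[of n] by (simp add: power_one_over)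
        have "x \<ominus> l \<ominus> q n = (x \<ominus> (p n \<oplus> q n)) \<oplus> (p n \<ominus> l)"
          using r_neg2[of "p n" "\<ominus> l \<oplus> \<ominus> q n"] x l c
          by (simp add: minus_eq minus_add a_ac)
        then have "nrm A (x \<ominus> l \<ominus> q n) < \<epsilon>"
          using nrm_triangle[of "x \<ominus> (p n \<oplus> q n)" "p n \<ominus> l"] x l c n N[of n] by (simp add: n_def)
        then show ?thesis using q by blast
      qed
      then show ?thesis using J x l unfolding closed_ideal_def norm_closedin_iff by blast
    qed
    moreover have "x = l \<oplus> (x \<ominus> l)" using x l by (simp add: minus_eq a_lcomm[of l x] r_neg)
    ultimately show "x \<in> I <+>\<^bsub>A\<^esub> J" unfolding set_add_iff by blast
  qed
  ultimately show ?thesis unfolding closed_ideal_def by blast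
qed

section \<open>Closed ideals of a quotient\<close>

context
  fixes I
  assumes I: "closed_ideal I A"
begin

interpretation abelian_subgroup I A
proof (rule abelian_subgroupI3)
  show "additive_subgroup I A"
    using submodule_of_ideal[OF I] by (intro additive_subgroup.intro submodule.axioms(1))
qed (rule M.abelian_group_axioms)

abbreviation Q where "Q \<equiv> quotient_alg A I"

lemma mem_coset_iff: "x \<in> carrier A \<Longrightarrow> y \<in> I +> x \<longleftrightarrow> (\<exists>m\<in>I. y = m \<oplus> x)"
  by (auto simp: a_r_coset_def r_coset_def)

lemma coset_eq_iff:
  assumes "x \<in> carrier A" "y \<in> carrier A"
  shows "I +> x = I +> y \<longleftrightarrow> x \<ominus> y \<in> I"
  using a_rcos_module[OF assms(2,1)] a_rcos_self[OF assms(1)] a_repr_independence'[of x y] assms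
  by (auto simp: minus_eq)

lemma coset_ideal [simp]: "m \<in> I \<Longrightarrow> I +> m = I"
  by (rule a_rcos_const)

lemma quotient_sel:
  "carrier Q = (\<lambda>x. I +> x) ` carrier A" "\<zero>\<^bsub>Q\<^esub> = I" "X \<oplus>\<^bsub>Q\<^esub> Y = X <+>\<^bsub>A\<^esub> Y"
  by (auto simp: quotient_alg_def A_RCOSETS_def' )

lemma quotient_add [simp]:
  "\<lbrakk>x \<in> carrier A; y \<in> carrier A\<rbrakk> \<Longrightarrow> (I +> x) \<oplus>\<^bsub>Q\<^esub> (I +> y) = I +> (x \<oplus> y)"
  by (simp add: quotient_sel a_rcos_sum)

text \<open>
  The operations of the quotient are unions over representatives. They reduce to operations on
  representatives once the result is known to be independent of the choice.
\<close>

lemma UN_const_coset: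
  assumes "x \<in> carrier A" "\<And>y. y \<in> I +> x \<Longrightarrow> F y = Z"
  shows "(\<Union>y\<in>I +> x. F y) = Z"
  using assms a_rcos_self[OF assms(1)] by blast

lemma quotient_smult [simp]:
  assumes x: "x \<in> carrier A"
  shows "c \<odot>\<^bsub>Q\<^esub> (I +> x) = I +> (c \<odot> x)"
proof -
  have "I +> (c \<odot> y) = I +> (c \<odot> x)" if y: "y \<in> I +> x" for y
  proof -
    obtain m where m: "m \<in> I" "y = m \<oplus> x" using y x by (auto simp: mem_coset_iff)
    have "c \<odot> y \<ominus> c \<odot> x = c \<odot> m" using m x by (simp add: scale_add_right minus_eq a_assoc r_neg)
    then show ?thesis using closed_idealD(5)[OF I] m x by (simp add: coset_eq_iff)
  qed
  then have "(\<Union>y\<in>I +> x. I +> (c \<odot> y)) = I +> (c \<odot> x)"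
    by (intro UN_const_coset[OF x]) blast
  then show ?thesis by (simp add: quotient_alg_def)
qed

lemma quotient_mult [simp]:
  assumes x: "x \<in> carrier A" and y: "y \<in> carrier A"
  shows "(I +> x) \<otimes>\<^bsub>Q\<^esub> (I +> y) = I +> (x \<otimes> y)"
proof -
  have "I +> (a \<otimes> b) = I +> (x \<otimes> y)" if a: "a \<in> I +> x" and b: "b \<in> I +> y" for a b
  proof -
    obtain m where m: "m \<in> I" "a = m \<oplus> x" using a x by (auto simp: mem_coset_iff)
    obtain n where n: "n \<in> I" "b = n \<oplus> y" using b y by (auto simp: mem_coset_iff)
    have "a \<otimes> b \<ominus> x \<otimes> y = m \<otimes> b \<oplus> x \<otimes> n"
      using m n x y by (simp add: mult_distrib_right mult_distrib_left minus_eq a_ac r_neg r_neg1 r_neg2)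
    also have "\<dots> \<in> I" using closed_idealD(3,6,7)[OF I] m n x y by simp
    finally show ?thesis using m n x y by (simp add: coset_eq_iff)
  qed
  then have "(\<Union>b\<in>I +> y. I +> (a \<otimes> b)) = I +> (x \<otimes> y)" if "a \<in> I +> x" for a
    using that by (intro UN_const_coset[OF y]) blast
  then have "(\<Union>a\<in>I +> x. \<Union>b\<in>I +> y. I +> (a \<otimes> b)) = I +> (x \<otimes> y)"
    by (intro UN_const_coset[OF x]) blast
  then show ?thesis by (simp add: quotient_alg_def rcoset_mult_def)
qed

lemma quotient_abelian_group: "abelian_group Q"
proof (rule abelian_groupI)
  fix X assume "X \<in> carrier Q"
  then obtain x where x: "x \<in> carrier A" "X = I +> x" by (auto simp: quotient_sel)
  have "I = I +> \<zero>" by simp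
  then show "\<zero>\<^bsub>Q\<^esub> \<oplus>\<^bsub>Q\<^esub> X = X" using x quotient_add[of \<zero> x] by (simp add: quotient_sel(2))
  show "\<exists>Y\<in>carrier Q. Y \<oplus>\<^bsub>Q\<^esub> X = \<zero>\<^bsub>Q\<^esub>"
    using x by (intro bexI[of _ "I +> (\<ominus> x)"]) (auto simp: l_neg quotient_sel(1,2))
next
  show "\<zero>\<^bsub>Q\<^esub> \<in> carrier Q" using imageI[OF M.zero_closed, of "\<lambda>x. I +> x"] by (simp add: quotient_sel)
qed (auto simp: quotient_sel(1) a_ac)

interpretation Q: abelian_group Q
  by (rule quotient_abelian_group)

lemma quotient_uminus [simp]: "x \<in> carrier A \<Longrightarrow> \<ominus>\<^bsub>Q\<^esub> (I +> x) = I +> (\<ominus> x)"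
  by (rule Q.minus_equality) (auto simp: quotient_sel(1,2) l_neg)

lemma quotient_minus [simp]:
  "\<lbrakk>x \<in> carrier A; y \<in> carrier A\<rbrakk> \<Longrightarrow> (I +> x) \<ominus>\<^bsub>Q\<^esub> (I +> y) = I +> (x \<ominus> y)"
  by (simp add: a_minus_def)

lemma quotient_nrm_less_iff:
  assumes x: "x \<in> carrier A"
  shows "nrm Q (I +> x) < r \<longleftrightarrow> (\<exists>m\<in>I. nrm A (m \<oplus> x) < r)"
proof -
  have "I +> x \<noteq> {}" using a_rcos_self[OF x] by blast
  moreover have "bdd_below (nrm A ` (I +> x))"
    using x nrm_nonneg by (intro bdd_belowI[of _ 0]) (auto simp: mem_coset_iff)
  ultimately have "nrm Q (I +> x) < r \<longleftrightarrow> (\<exists>y\<in>I +> x. nrm A y < r)"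
    by (simp add: quotient_alg_def cINF_less_iff)
  then show ?thesis using x by (auto simp: mem_coset_iff)
qed

lemma quotient_nrm_nonneg: "x \<in> carrier A \<Longrightarrow> 0 \<le> nrm Q (I +> x)"
  using quotient_nrm_less_iff[of x 0] nrm_nonneg by (force simp: not_le[symmetric])

lemma quotient_nrm_le: "x \<in> carrier A \<Longrightarrow> nrm Q (I +> x) \<le> nrm A x"
  using quotient_nrm_less_iff[of x] closed_idealD(2)[OF I] by (metis l_zero less_irrefl not_le)

text \<open>The quotient seminorm is a norm because \<open>I\<close> is closed.\<close>

lemma quotient_nrm_eq_zero_iff:
  assumes x: "x \<in> carrier A"
  shows "nrm Q (I +> x) = 0 \<longleftrightarrow> x \<in> I"
proof
  assume "x \<in> I"
  then show "nrm Q (I +> x) = 0"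
    using quotient_nrm_le[OF M.zero_closed] quotient_nrm_nonneg[OF M.zero_closed] closed_idealD(2)[OF I] by simp
next
  assume z: "nrm Q (I +> x) = 0"
  have "\<exists>y\<in>I. nrm A (x \<ominus> y) < \<epsilon>" if "0 < \<epsilon>" for \<epsilon>
  proof -
    obtain m where m: "m \<in> I" "nrm A (m \<oplus> x) < \<epsilon>"
      using quotient_nrm_less_iff[OF x, of \<epsilon>] z \<open>0 < \<epsilon>\<close> by auto
    then have "nrm A (x \<ominus> \<ominus> m) < \<epsilon>" using x by (simp add: minus_eq a_comm)
    then show ?thesis using m by blast
  qed
  then show "x \<in> I" using I x unfolding closed_ideal_def norm_closedin_iff by blast
qed

lemma quotient_nrm_minus_commute:
  assumes "x \<in> carrier A" "y \<in> carrier A"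
  shows "nrm Q (I +> (x \<ominus> y)) = nrm Q (I +> (y \<ominus> x))"
proof -
  have le: "nrm Q (I +> (y \<ominus> x)) \<le> nrm Q (I +> (x \<ominus> y))" if c: "x \<in> carrier A" "y \<in> carrier A" for x y
  proof (rule dense_ge)
    fix r assume "nrm Q (I +> (x \<ominus> y)) < r"
    then obtain m where m: "m \<in> I" "nrm A (m \<oplus> (x \<ominus> y)) < r"
      using c by (auto simp: quotient_nrm_less_iff)
    have "nrm A (\<ominus> m \<oplus> (y \<ominus> x)) = nrm A (\<ominus> (m \<oplus> (x \<ominus> y)))"
      using m c by (simp add: minus_eq minus_add a_ac)
    then have "nrm A (\<ominus> m \<oplus> (y \<ominus> x)) < r" using m c by (simp add: nrm_uminus)
    then have "nrm Q (I +> (y \<ominus> x)) < r"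
      using m c by (auto simp: quotient_nrm_less_iff)
    then show "nrm Q (I +> (y \<ominus> x)) \<le> r" by simp
  qed
  show ?thesis using le[OF assms] le[OF assms(2,1)] by simp
qed

lemma quotient_nrm_triangle:
  assumes x: "x \<in> carrier A" and y: "y \<in> carrier A"
  shows "nrm Q (I +> (x \<oplus> y)) \<le> nrm Q (I +> x) + nrm Q (I +> y)"
proof (rule field_le_epsilon)
  fix e :: real assume "0 < e"
  then obtain m n where m: "m \<in> I" "nrm A (m \<oplus> x) < nrm Q (I +> x) + e / 2"
    and n: "n \<in> I" "nrm A (n \<oplus> y) < nrm Q (I +> y) + e / 2"
    using quotient_nrm_less_iff[OF x, of "nrm Q (I +> x) + e / 2"]
      quotient_nrm_less_iff[OF y, of "nrm Q (I +> y) + e / 2"] by auto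
  have "(m \<oplus> n) \<oplus> (x \<oplus> y) = (m \<oplus> x) \<oplus> (n \<oplus> y)" using m n x y by (simp add: a_ac)
  then have "nrm A ((m \<oplus> n) \<oplus> (x \<oplus> y)) < nrm Q (I +> x) + nrm Q (I +> y) + e"
    using nrm_triangle[of "m \<oplus> x" "n \<oplus> y"] m n x y by simp
  then have "nrm Q (I +> (x \<oplus> y)) < nrm Q (I +> x) + nrm Q (I +> y) + e"
    using m n x y closed_idealD(3)[OF I] quotient_nrm_less_iff[of "x \<oplus> y"] by blast
  then show "nrm Q (I +> (x \<oplus> y)) \<le> nrm Q (I +> x) + nrm Q (I +> y) + e" by simp
qed

lemma quotient_Metric_space: "Metric_space (carrier Q) (ndist Q)"
proof
  fix X Y Z assume "X \<in> carrier Q" "Y \<in> carrier Q" "Z \<in> carrier Q"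
  then obtain x y z where c: "x \<in> carrier A" "y \<in> carrier A" "z \<in> carrier A"
    and [simp]: "X = I +> x" "Y = I +> y" "Z = I +> z" by (auto simp: quotient_sel(1))
  have "(x \<ominus> y) \<oplus> (y \<ominus> z) = x \<ominus> z" using c by (simp add: minus_eq a_assoc r_neg1)
  then show "ndist Q X Z \<le> ndist Q X Y + ndist Q Y Z"
    using c quotient_nrm_triangle[of "x \<ominus> y" "y \<ominus> z"] by (simp add: ndist_def quotient_sel(1))
next
  fix X Y assume "X \<in> carrier Q" "Y \<in> carrier Q"
  then obtain x y where "x \<in> carrier A" "y \<in> carrier A" "X = I +> x" "Y = I +> y"
    by (auto simp: quotient_sel(1))
  then show "ndist Q X Y = 0 \<longleftrightarrow> X = Y"
    by (simp add: ndist_def quotient_sel(1) quotient_nrm_eq_zero_iff coset_eq_iff)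
qed (auto simp: ndist_def quotient_sel(1) quotient_nrm_nonneg quotient_nrm_minus_commute)

text \<open>
  Closedness in the quotient is expressed by approximation of representatives up to elements
  of \<open>I\<close>. In this form it can be compared directly with closedness in \<open>A\<close>.
\<close>

lemma quotient_closedin_iff:
  "closedin (norm_topology Q) S \<longleftrightarrow>
    S \<subseteq> carrier Q \<and>
    (\<forall>x\<in>carrier A. (\<forall>\<epsilon>>0. \<exists>y\<in>carrier A. I +> y \<in> S \<and> (\<exists>m\<in>I. nrm A (m \<oplus> (x \<ominus> y)) < \<epsilon>)) \<longrightarrow> I +> x \<in> S)"
  (is "?lhs \<longleftrightarrow> _ \<and> (\<forall>x\<in>carrier A. ?near x \<longrightarrow> _)")
proof -
  have near: "(\<forall>\<epsilon>>0. \<exists>Y\<in>S. ndist Q (I +> x) Y < \<epsilon>) \<longleftrightarrow> ?near x"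
    if x: "x \<in> carrier A" and S: "S \<subseteq> carrier Q" for x
  proof -
    have "ndist Q (I +> x) (I +> y) < \<epsilon> \<longleftrightarrow> (\<exists>m\<in>I. nrm A (m \<oplus> (x \<ominus> y)) < \<epsilon>)"
      if "y \<in> carrier A" for y \<epsilon>
      using x that by (simp add: ndist_def quotient_sel(1) quotient_nrm_less_iff)
    moreover have "(\<exists>Y\<in>S. P Y) \<longleftrightarrow> (\<exists>y\<in>carrier A. I +> y \<in> S \<and> P (I +> y))" for P
      using S by (auto simp: quotient_sel(1))
    ultimately show ?thesis by (simp cong: conj_cong bex_cong)
  qed
  have "?lhs \<longleftrightarrow> S \<subseteq> carrier Q \<and>
      (\<forall>x\<in>carrier A. (\<forall>\<epsilon>>0. \<exists>Y\<in>S. ndist Q (I +> x) Y < \<epsilon>) \<longrightarrow> I +> x \<in> S)"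
    unfolding norm_topology_def Metric_space.closedin_iff_approx[OF quotient_Metric_space]
    by (simp add: quotient_sel(1))
  then show ?thesis using near by blast
qed

lemma coset_mem_quotient_ideal_iff:
  assumes J: "closed_ideal J A" and IJ: "I \<subseteq> J" and x: "x \<in> carrier A"
  shows "I +> x \<in> quotient_ideal A J I \<longleftrightarrow> x \<in> J"
proof
  assume "I +> x \<in> quotient_ideal A J I"
  then obtain j where j: "j \<in> J" "I +> x = I +> j" by (auto simp: quotient_ideal_def)
  then have jc: "j \<in> carrier A" using closed_idealD(1)[OF J] by auto
  have "x \<ominus> j \<in> J" using j jc x IJ by (auto simp: coset_eq_iff)
  then have "(x \<ominus> j) \<oplus> j \<in> J" using closed_idealD(3)[OF J] j by simp
  then show "x \<in> J" using x jc by (simp add: minus_eq a_assoc l_neg)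
qed (auto simp: quotient_ideal_def)

text \<open>
  For closedness: if the coset of \<open>x\<close> is approximated by cosets of elements of \<open>J\<close>, then \<open>x\<close> itself is
  approximated by elements of \<open>J + I = J\<close>.
\<close>

lemma closed_ideal_quotient_ideal:
  assumes J: "closed_ideal J A" and IJ: "I \<subseteq> J"
  shows "closed_ideal (quotient_ideal A J I) Q"
proof -
  note J' = closed_idealD[OF J]
  let ?J = "quotient_ideal A J I"
  have J_iff: "X \<in> ?J \<longleftrightarrow> (\<exists>j\<in>J. X = I +> j)" for X by (auto simp: quotient_ideal_def)
  have sub: "?J \<subseteq> carrier Q" using J'(1) by (auto simp: quotient_ideal_def quotient_sel(1))
  have "submodule ?J complex_ring Q"
  proof (intro submodule.intro subgroup.intro submodule_axioms.intro)
    fix X assume "X \<in> ?J"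
    then obtain j where j: "j \<in> J" "X = I +> j" by (auto simp: J_iff)
    then have jc: "j \<in> carrier A" using J'(1) by auto
    have "inv\<^bsub>add_monoid Q\<^esub> X = I +> (\<ominus> j)" using quotient_uminus[OF jc] j by (simp add: a_inv_def)
    then show "inv\<^bsub>add_monoid Q\<^esub> X \<in> ?J" using J'(4) j by (auto simp: J_iff)
    fix c :: complex
    show "c \<odot>\<^bsub>Q\<^esub> X \<in> ?J" using J'(5) j jc by (auto simp: J_iff)
    fix Y assume "Y \<in> ?J"
    then obtain k where k: "k \<in> J" "Y = I +> k" by (auto simp: J_iff)
    then have "k \<in> carrier A" using J'(1) by auto
    then have "X \<otimes>\<^bsub>add_monoid Q\<^esub> Y = I +> (j \<oplus> k)" using j jc k by simp
    then show "X \<otimes>\<^bsub>add_monoid Q\<^esub> Y \<in> ?J" using J'(3) j k unfolding J_iff by blast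
  next
    show "\<one>\<^bsub>add_monoid Q\<^esub> \<in> ?J" using J'(2) closed_idealD(2)[OF I]
      by (auto simp: J_iff quotient_sel(2) intro!: bexI[of _ \<zero>])
  qed (use sub in auto)
  moreover have "X \<otimes>\<^bsub>Q\<^esub> Y \<in> ?J \<and> Y \<otimes>\<^bsub>Q\<^esub> X \<in> ?J" if "X \<in> carrier Q" "Y \<in> ?J" for X Y
  proof -
    obtain a where a: "a \<in> carrier A" "X = I +> a" using \<open>X \<in> carrier Q\<close> by (auto simp: quotient_sel(1))
    obtain j where j: "j \<in> J" "Y = I +> j" using \<open>Y \<in> ?J\<close> by (auto simp: J_iff)
    then have "j \<in> carrier A" using J'(1) by auto
    then show ?thesis using a j J'(6,7) by (auto simp: J_iff)
  qed
  moreover have "closedin (norm_topology Q) ?J"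
    unfolding quotient_closedin_iff
  proof (intro conjI sub ballI impI)
    fix x assume x: "x \<in> carrier A"
    assume near: "\<forall>\<epsilon>>0. \<exists>y\<in>carrier A. I +> y \<in> ?J \<and> (\<exists>m\<in>I. nrm A (m \<oplus> (x \<ominus> y)) < \<epsilon>)"
    have "\<exists>y\<in>J. nrm A (x \<ominus> y) < \<epsilon>" if \<epsilon>: "0 < \<epsilon>" for \<epsilon>
    proof -
      obtain y m where y: "y \<in> carrier A" "I +> y \<in> ?J" and m: "m \<in> I" "nrm A (m \<oplus> (x \<ominus> y)) < \<epsilon>"
        using near \<epsilon> by blast
      have yJ: "y \<in> J" using coset_mem_quotient_ideal_iff[OF J IJ y(1)] y(2) by simp
      have "m \<oplus> (x \<ominus> y) = x \<ominus> (y \<ominus> m)" using m x y by (simp add: minus_eq minus_add a_ac)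
      moreover have "y \<ominus> m \<in> J" using yJ m IJ J'(3,4) by (auto simp: minus_eq)
      ultimately show ?thesis using m by metis
    qed
    then have "x \<in> J" using J x unfolding closed_ideal_def norm_closedin_iff by blast
    then show "I +> x \<in> ?J" by (auto simp: J_iff)
  qed
  ultimately show ?thesis unfolding closed_ideal_def by blast
qed

text \<open>The ideal \<open>K\<close> is the preimage of \<open>L\<close>; it is closed since the quotient map is contractive.\<close>

lemma closed_ideal_of_quotient:
  assumes L: "closed_ideal L Q"
  obtains K where "closed_ideal K A" "I \<subseteq> K" "quotient_ideal A K I = L"
proof
  define K where "K = {x \<in> carrier A. I +> x \<in> L}"
  interpret L: submodule L complex_ring Q using L by (simp add: closed_ideal_def)
  have L_sub: "L \<subseteq> carrier Q" using L.subset by simp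
  have L_mult: "X \<otimes>\<^bsub>Q\<^esub> Y \<in> L \<and> Y \<otimes>\<^bsub>Q\<^esub> X \<in> L" if "X \<in> carrier Q" "Y \<in> L" for X Y
    using L that by (simp add: closed_ideal_def)
  have L_closed: "closedin (norm_topology Q) L" using L by (simp add: closed_ideal_def)
  have zero: "I \<in> L" using L.one_closed by (simp add: quotient_sel(2))
  show "I \<subseteq> K" using closed_idealD(1)[OF I] zero by (auto simp: K_def)
  show "quotient_ideal A K I = L"
    using L_sub by (auto simp: quotient_ideal_def K_def quotient_sel(1))
  have add: "I +> (x \<oplus> y) \<in> L" if "x \<in> K" "y \<in> K" for x y
    using that L.m_closed[of "I +> x" "I +> y"] by (simp add: K_def)
  have neg: "I +> (\<ominus> x) \<in> L" if "x \<in> K" for x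
  proof -
    have "\<ominus>\<^bsub>Q\<^esub> (I +> x) \<in> L"
      using that L.m_inv_closed[of "I +> x"] unfolding a_inv_def[of Q] by (simp add: K_def)
    then show ?thesis using that by (simp add: K_def)
  qed
  have scale: "I +> (c \<odot> x) \<in> L" if "x \<in> K" for c x
    using that L.smult_closed[of c "I +> x"] by (simp add: K_def)
  have "submodule K complex_ring A"
    by (rule submoduleI) (use zero add neg scale in \<open>auto simp: K_def closed_idealD(2)[OF I]\<close>)
  moreover have "a \<otimes> x \<in> K \<and> x \<otimes> a \<in> K" if "a \<in> carrier A" "x \<in> K" for a x
    using that L_mult[of "I +> a" "I +> x"] by (auto simp: K_def quotient_sel(1))
  moreover have "closedin (norm_topology A) K"
    unfolding norm_closedin_iff
  proof (intro conjI ballI impI)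
    fix x assume x: "x \<in> carrier A" and near: "\<forall>\<epsilon>>0. \<exists>y\<in>K. nrm A (x \<ominus> y) < \<epsilon>"
    have "\<exists>y\<in>carrier A. I +> y \<in> L \<and> (\<exists>m\<in>I. nrm A (m \<oplus> (x \<ominus> y)) < \<epsilon>)" if \<epsilon>: "0 < \<epsilon>" for \<epsilon>
    proof -
      obtain y where y: "y \<in> K" "nrm A (x \<ominus> y) < \<epsilon>" using near \<epsilon> by blast
      then have "nrm A (\<zero> \<oplus> (x \<ominus> y)) < \<epsilon>" using x by (simp add: K_def)
      moreover have "y \<in> carrier A" "I +> y \<in> L" using y by (auto simp: K_def)
      ultimately show ?thesis using closed_idealD(2)[OF I] by blast
    qed
    then show "x \<in> K" using L_closed x by (auto simp: quotient_closedin_iff K_def)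
  qed (auto simp: K_def)
  ultimately show "closed_ideal K A" unfolding closed_ideal_def by blast
qed

lemma quotient_ideal_eq_carrier_iff:
  assumes "closed_ideal J A" "I \<subseteq> J"
  shows "quotient_ideal A J I = carrier Q \<longleftrightarrow> J = carrier A"
  using coset_mem_quotient_ideal_iff[OF assms] closed_idealD(1)[OF assms(1)]
  by (auto simp: quotient_sel(1) quotient_ideal_def)

lemma quotient_ideal_set_add:
  assumes "closed_ideal J A" "closed_ideal K A"
  shows "quotient_ideal A J I <+>\<^bsub>Q\<^esub> quotient_ideal A K I = quotient_ideal A (J <+>\<^bsub>A\<^esub> K) I"
proof -
  have "j \<in> carrier A" if "j \<in> J \<union> K" for j
    using that closed_idealD(1)[OF assms(1)] closed_idealD(1)[OF assms(2)] by auto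
  then have add: "(I +> j) \<oplus>\<^bsub>Q\<^esub> (I +> k) = I +> (j \<oplus> k)" if "j \<in> J" "k \<in> K" for j k
    using that by simp
  show ?thesis
    unfolding quotient_ideal_def set_add_def set_mult_def
    using add by (force simp: image_iff)
qed

lemma quotient_trivial_iff: "carrier Q = {\<zero>\<^bsub>Q\<^esub>} \<longleftrightarrow> I = carrier A"
proof -
  have "quotient_ideal A I I = (\<lambda>_. I) ` I"
    unfolding quotient_ideal_def by (rule image_cong[OF refl coset_ideal])
  also have "\<dots> = {I}" using closed_idealD(2)[OF I] by blast
  finally have "carrier Q = {\<zero>\<^bsub>Q\<^esub>} \<longleftrightarrow> quotient_ideal A I I = carrier Q"
    unfolding quotient_sel(2) by (simp only: eq_commute)
  also have "\<dots> \<longleftrightarrow> I = carrier A" by (rule quotient_ideal_eq_carrier_iff[OF I order_refl])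
  finally show ?thesis .
qed

end

section \<open>The smallness relation\<close>

lemma set_add_superset:
  assumes "closed_ideal J A" "closed_ideal K A"
  shows "J \<subseteq> J <+>\<^bsub>A\<^esub> K" "K \<subseteq> J <+>\<^bsub>A\<^esub> K"
proof -
  note J = closed_idealD[OF assms(1)] and K = closed_idealD[OF assms(2)]
  show "J \<subseteq> J <+>\<^bsub>A\<^esub> K"
  proof
    fix x assume "x \<in> J"
    moreover then have "x = x \<oplus> \<zero>" using J(1) by auto
    ultimately show "x \<in> J <+>\<^bsub>A\<^esub> K" using K(2) unfolding set_add_iff by blast
  qed
  show "K \<subseteq> J <+>\<^bsub>A\<^esub> K"
  proof
    fix x assume "x \<in> K"
    moreover then have "x = \<zero> \<oplus> x" using K(1) by auto
    ultimately show "x \<in> J <+>\<^bsub>A\<^esub> K" using J(2) unfolding set_add_iff by blast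
  qed
qed

lemma set_add_subset:
  assumes "closed_ideal L A" "J \<subseteq> L" "K \<subseteq> L"
  shows "J <+>\<^bsub>A\<^esub> K \<subseteq> L"
  using assms closed_idealD(3)[OF assms(1)] by (auto simp: set_add_iff subset_iff)

text \<open>
  Smallness of \<open>J/I\<close> in \<open>A/I\<close> is transported along the correspondence of closed ideals.
  If \<open>I = A\<close>, both sides hold trivially: the quotient is zero, and \<open>A\<close> is the only ideal
  containing \<open>I\<close>.
\<close>

theorem small_rel_iff:
  "(I, J) \<in> small_rel A \<longleftrightarrow>
    closed_ideal I A \<and> closed_ideal J A \<and> I \<subseteq> J \<and>
    (\<forall>K. closed_ideal K A \<longrightarrow> I \<subseteq> K \<longrightarrow> J <+>\<^bsub>A\<^esub> K = carrier A \<longrightarrow> K = carrier A)"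
proof (cases "closed_ideal I A \<and> closed_ideal J A \<and> I \<subseteq> J")
  case True
  then have I: "closed_ideal I A" and J: "closed_ideal J A" and IJ: "I \<subseteq> J" by auto
  let ?Q = "quotient_alg A I"
  let ?q = "\<lambda>J. quotient_ideal A J I"
  have sum_eq: "?q J <+>\<^bsub>?Q\<^esub> ?q K = carrier ?Q \<longleftrightarrow> J <+>\<^bsub>A\<^esub> K = carrier A"
    if "closed_ideal K A" "I \<subseteq> K" for K
    using quotient_ideal_set_add[OF I J that(1)]
      quotient_ideal_eq_carrier_iff[OF I closed_ideal_set_add[OF J that(1)]]
      set_add_superset[OF J that(1)] IJ by auto
  have all_iff: "(\<forall>L\<in>ideals ?Q. P L) \<longleftrightarrow> (\<forall>K. closed_ideal K A \<longrightarrow> I \<subseteq> K \<longrightarrow> P (?q K))" for P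
    using closed_ideal_quotient_ideal[OF I] closed_ideal_of_quotient[OF I]
    unfolding ideals_def by (metis mem_Collect_eq)
  have "small_ideal ?Q (?q J) \<longleftrightarrow>
      (\<forall>K. closed_ideal K A \<longrightarrow> I \<subseteq> K \<longrightarrow> J <+>\<^bsub>A\<^esub> K = carrier A \<longrightarrow> K = carrier A)"
  proof (cases "I = carrier A")
    case True
    then have "J = carrier A" using IJ closed_idealD(1)[OF J] by auto
    then have "?q J = carrier ?Q" using quotient_ideal_eq_carrier_iff[OF I J IJ] by simp
    then have "small_ideal ?Q (?q J)"
      using True quotient_trivial_iff[OF I] closed_ideal_quotient_ideal[OF I J IJ]
      by (auto simp: small_ideal_def ideals_def)
    moreover have "K = carrier A" if "closed_ideal K A" "I \<subseteq> K" for K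
      using True that closed_idealD(1) by blast
    ultimately show ?thesis by blast
  next
    case False
    then have "small_ideal ?Q (?q J) \<longleftrightarrow>
        (\<forall>L\<in>ideals ?Q. L \<noteq> carrier ?Q \<longrightarrow> ?q J <+>\<^bsub>?Q\<^esub> L \<noteq> carrier ?Q)"
      using quotient_trivial_iff[OF I] closed_ideal_quotient_ideal[OF I J IJ]
      by (auto simp: small_ideal_def ideals_def)
    then show ?thesis
      unfolding all_iff by (auto simp: sum_eq quotient_ideal_eq_carrier_iff[OF I])
  qed
  then show ?thesis using I J IJ by (auto simp: small_rel_def ideals_def)
qed (auto simp: small_rel_def ideals_def)

lemma small_rel_refl:
  assumes "closed_ideal I A"
  shows "(I, I) \<in> small_rel A"
  unfolding small_rel_iff
proof (intro conjI assms allI impI order_refl)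
  fix K assume K: "closed_ideal K A" and "I \<subseteq> K" and sum: "I <+>\<^bsub>A\<^esub> K = carrier A"
  then have "carrier A \<subseteq> K" using set_add_subset[OF K \<open>I \<subseteq> K\<close> order_refl] by simp
  then show "K = carrier A" using closed_idealD(1)[OF K] by blast
qed

lemma small_rel_set_add:
  assumes IJ: "(I, J) \<in> small_rel A" and K: "closed_ideal K A" and IK: "I \<subseteq> K"
  shows "(K, J <+>\<^bsub>A\<^esub> K) \<in> small_rel A"
proof -
  have J: "closed_ideal J A"
    and small: "\<And>L. closed_ideal L A \<Longrightarrow> I \<subseteq> L \<Longrightarrow> J <+>\<^bsub>A\<^esub> L = carrier A \<Longrightarrow> L = carrier A"
    using IJ unfolding small_rel_iff by blast+
  have "L = carrier A"
    if L: "closed_ideal L A" and KL: "K \<subseteq> L" and sum: "(J <+>\<^bsub>A\<^esub> K) <+>\<^bsub>A\<^esub> L = carrier A" for L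
  proof -
    have JL: "closed_ideal (J <+>\<^bsub>A\<^esub> L) A" by (rule closed_ideal_set_add[OF J L])
    note sup = set_add_superset[OF J L]
    have "J <+>\<^bsub>A\<^esub> K \<subseteq> J <+>\<^bsub>A\<^esub> L" using set_add_subset[OF JL] sup KL by blast
    then have "carrier A \<subseteq> J <+>\<^bsub>A\<^esub> L" using set_add_subset[OF JL _ sup(2)] sum by blast
    then have "J <+>\<^bsub>A\<^esub> L = carrier A" using closed_idealD(1)[OF JL] by blast
    then show ?thesis using small[OF L] IK KL by blast
  qed
  then show ?thesis
    unfolding small_rel_iff using K closed_ideal_set_add[OF J K] set_add_superset(2)[OF J K] by blast
qed

lemma small_rel_trans:
  assumes IJ: "(I, J) \<in> small_rel A" and JL: "(J, L) \<in> small_rel A"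
  shows "(I, L) \<in> small_rel A"
proof -
  have I: "closed_ideal I A" and J: "closed_ideal J A" and L: "closed_ideal L A"
    and sub: "I \<subseteq> J" "J \<subseteq> L"
    and smallJ: "\<And>K. closed_ideal K A \<Longrightarrow> I \<subseteq> K \<Longrightarrow> J <+>\<^bsub>A\<^esub> K = carrier A \<Longrightarrow> K = carrier A"
    and smallL: "\<And>K. closed_ideal K A \<Longrightarrow> J \<subseteq> K \<Longrightarrow> L <+>\<^bsub>A\<^esub> K = carrier A \<Longrightarrow> K = carrier A"
    using IJ JL unfolding small_rel_iff by blast+
  have "K = carrier A"
    if K: "closed_ideal K A" and IK: "I \<subseteq> K" and sum: "L <+>\<^bsub>A\<^esub> K = carrier A" for K
  proof -
    let ?M = "J <+>\<^bsub>A\<^esub> K"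
    have M: "closed_ideal ?M A" by (rule closed_ideal_set_add[OF J K])
    have LM: "closed_ideal (L <+>\<^bsub>A\<^esub> ?M) A" by (rule closed_ideal_set_add[OF L M])
    note sup = set_add_superset[OF J K] set_add_superset[OF L M]
    have "L <+>\<^bsub>A\<^esub> K \<subseteq> L <+>\<^bsub>A\<^esub> ?M" using set_add_subset[OF LM] sup by blast
    then have "L <+>\<^bsub>A\<^esub> ?M = carrier A" using sum closed_idealD(1)[OF LM] by blast
    then have "?M = carrier A" using smallL[OF M] sup by blast
    then show ?thesis using smallJ[OF K IK] by blast
  qed
  then show ?thesis unfolding small_rel_iff using I L sub by blast
qed

end

theorem corollary7p14:
  fixes A :: "'a cstar_struct"
  assumes "cstar_algebra A"
  shows "H_relation A (small_rel A) \<and> trans (small_rel A)"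
proof -
  interpret cstar_algebra A by fact
  have sub: "small_rel A \<subseteq> ideals A \<times> ideals A"
    by (auto simp: small_rel_def)
  have "refl_on (ideals A) (small_rel A)"
    using small_rel_refl by (auto intro!: refl_onI simp: ideals_def)
  moreover have "trans (small_rel A)"
    using small_rel_trans by (blast intro: transI)
  ultimately show ?thesis
    unfolding H_relation_def using sub
  proof (intro conjI allI impI)
    show "I \<subseteq> J" if "(I, J) \<in> small_rel A" for I J
      using that by (simp add: small_rel_def)
    show "(K, J <+>\<^bsub>A\<^esub> K) \<in> small_rel A"
      if "(I, J) \<in> small_rel A \<and> K \<in> ideals A \<and> I \<subseteq> K" for I J K
      using that small_rel_set_add unfolding ideals_def by blast
  qed
qed

end
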